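(* Let $\{(\boldsymbol{x}_i,y_i)\}_{i=1}^n$ with $\boldsymbol{x}_i\in\mathbb{R}^d$, $\|\boldsymbol{x}_i\|\le1$, $y_i\in\{-1,+1\}$ be linearly separable. Let $\ell:\mathbb{R}\to\mathbb{R}$ be convex, differentiable and strictly decreasing to $0$, and suppose that for some $a,b>0$, $$\lim_{z\to\infty}\frac{-\ell'(z)}{az^{-b}}=1.$$ For $B>0$ let $\bar{\boldsymbol{w}}(B)=\arg\min_{\|\boldsymbol{w}\|\le B}\mathcal{R}(\boldsymbol{w})$ where $\mathcal{R}(\boldsymbol{w})=\frac1n\sum_{i=1}^n\ell(y_i\langle\boldsymbol{w},\boldsymbol{x}_i\rangle)$. Then $\lim_{B\to\infty}\bar{\boldsymbol{w}}(B)/B$ exists.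
   Context: $\|\cdot\|$ is the Euclidean norm. "Linearly separable" means there exist a unit vector $\boldsymbol{u}$ and $\gamma>0$ with $y_i\langle\boldsymbol{u},\boldsymbol{x}_i\rangle\ge\gamma$ for all $i$. "Strictly decreasing to $0$" means strictly decreasing with $\lim_{z\to\infty}\ell(z)=0$. Under these assumptions the infimum of $\mathcal{R}$ is not attained and $\bar{\boldsymbol{w}}(B)$ is unique. *)

theory Defs
  imports "HOL-Analysis.Analysis"
begin

definition linearly_separable ::
  "nat \<Rightarrow> (nat \<Rightarrow> real ^ 'd) \<Rightarrow> (nat \<Rightarrow> real) \<Rightarrow> bool" where
  "linearly_separable n x y \<longleftrightarrow>
     (\<exists>u \<gamma>. norm u = 1 \<and> \<gamma> > 0 \<and> (\<forall>i\<in>{1..n}. y i * (u \<bullet> x i) \<ge> \<gamma>))"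

definition strictly_decreasing_to_zero :: "(real \<Rightarrow> real) \<Rightarrow> bool" where
  "strictly_decreasing_to_zero l \<longleftrightarrow>
     (\<forall>s t. s < t \<longrightarrow> l t < l s) \<and> (l \<longlongrightarrow> 0) at_top"

definition empirical_risk ::
  "(real \<Rightarrow> real) \<Rightarrow> nat \<Rightarrow> (nat \<Rightarrow> real ^ 'd) \<Rightarrow> (nat \<Rightarrow> real) \<Rightarrow> real ^ 'd \<Rightarrow> real" where
  "empirical_risk l n x y w = (1 / real n) * (\<Sum>i=1..n. l (y i * (w \<bullet> x i)))"

(* ARG_MIN selects some minimizer; it is the minimizer in the intended setting, since the continuous
   convex risk then attains its minimum on the ball, and, its infimum over the whole space not
   being attained, only at a single point. *)
definition constrained_minimizer ::
  "(real \<Rightarrow> real) \<Rightarrow> nat \<Rightarrow> (nat \<Rightarrow> real ^ 'd) \<Rightarrow> (nat \<Rightarrow> real) \<Rightarrow> real \<Rightarrow> real ^ 'd" where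
  "constrained_minimizer l n x y B = (ARG_MIN (empirical_risk l n x y) w. norm w \<le> B)"

end

theory Submission imports Defs begin

text \<open>Since \<open>l\<close> tends to \<open>0\<close>, its derivative is integrable at infinity; hence \<open>b > 1\<close>, and with
  \<open>m = b - 1\<close> one gets \<open>s\<^sup>m l(s) \<rightarrow> a / m\<close>. Rescaling \<open>w = B u\<close>, the risk multiplied by \<open>B\<^sup>m\<close> converges to
  a multiple of \<open>G(u) = \<Sum>\<^sub>i \<langle>u, y\<^sub>i x\<^sub>i\<rangle>\<^sup>-\<^sup>m\<close>, and every cluster point of \<open>w(B) / B\<close> minimises \<open>G\<close> over the
  vectors of the unit ball that separate the data. That minimiser is unique: the midpoint of two distinct
  ones lies strictly inside the ball, and stretching it to the sphere strictly decreases \<open>G\<close>. Compactness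
  of the ball then gives convergence.\<close>

section \<open>Asymptotics of the loss\<close>

text \<open>A nonincreasing function stays above its limit. This turns a comparison of derivatives
  on a half-line into a comparison of functions that vanish at infinity.\<close>

lemma nonneg_if_deriv_nonpos_tendsto_0:
  fixes f :: "real \<Rightarrow> real"
  assumes "\<And>t. t \<ge> z \<Longrightarrow> (f has_real_derivative f' t) (at t)"
    and "\<And>t. t \<ge> z \<Longrightarrow> f' t \<le> 0"
    and "(f \<longlongrightarrow> 0) at_top"
  shows "f z \<ge> 0"
proof -
  have "f t \<le> f z" if "t \<ge> z" for t
    using DERIV_nonpos_imp_nonincreasing[of z t f] that assms(1,2) by blast
  then have "\<forall>\<^sub>F t in at_top. f t \<le> f z"
    using eventually_at_top_linorder by blast
  then show ?thesis
    using tendsto_upperbound[OF assms(3)] by simp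
qed

text \<open>For \<open>b \<le> 1\<close> the slope \<open>- l' z\<close> would eventually be at
  least \<open>a / (2 * z)\<close>, whose integral diverges logarithmically, so \<open>l\<close>
  could not have a finite limit.\<close>

lemma tail_exponent_gt_1:
  fixes l :: "real \<Rightarrow> real"
  assumes der: "\<And>t. (l has_real_derivative l' t) (at t)"
    and lim: "(l \<longlongrightarrow> 0) at_top"
    and "a > 0"
    and asym: "((\<lambda>z. - l' z / (a * z powr (- b))) \<longlongrightarrow> 1) at_top"
  shows "b > 1"
proof (rule ccontr)
  assume "\<not> b > 1"
  have "\<forall>\<^sub>F z in at_top. - l' z / (a * z powr (- b)) > 1 / 2"
    using order_tendstoD(1)[OF asym, of "1 / 2"] by simp
  then obtain Z0 where Z0: "\<And>z. z \<ge> Z0 \<Longrightarrow> - l' z / (a * z powr (- b)) > 1 / 2"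
    by (auto simp: eventually_at_top_linorder)
  define Z where "Z = max Z0 1"
  \<comment> \<open>The contradiction comes from \<open>h\<close>: it is nonincreasing from
    \<open>Z\<close> on, yet tends to infinity because \<open>l\<close> tends to
    \<open>0\<close>.\<close>
  define h where "h = (\<lambda>z. l z + a / 2 * ln z)"
  have "l' z + a / 2 * inverse z \<le> 0" if "z \<ge> Z" for z
  proof -
    have z: "z \<ge> Z0" "z \<ge> 1"
      using that by (auto simp: Z_def)
    have "inverse z = z powr (- 1)"
      using z by (simp add: powr_minus)
    also have "\<dots> \<le> z powr (- b)"
      using z \<open>\<not> b > 1\<close> by (intro powr_mono) auto
    finally have "a / 2 * inverse z \<le> a / 2 * z powr (- b)"
      using \<open>a > 0\<close> by (intro mult_left_mono) auto
    also have "\<dots> \<le> - l' z"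
      using Z0[OF z(1)] z \<open>a > 0\<close> by (simp add: field_simps)
    finally show ?thesis by simp
  qed
  moreover have "(h has_real_derivative l' z + a / 2 * inverse z) (at z)" if "z \<ge> Z" for z
    unfolding h_def using that by (auto intro!: derivative_eq_intros der simp: Z_def field_simps)
  ultimately have "h z \<le> h Z" if "z \<ge> Z" for z
    using DERIV_nonpos_imp_nonincreasing[of Z z h] that by blast
  then have bdd: "\<forall>\<^sub>F z in at_top. h z \<le> h Z"
    using eventually_at_top_linorder by blast
  have "filterlim (\<lambda>z. a / 2 * ln z) at_top at_top"
    using \<open>a > 0\<close> by (intro filterlim_tendsto_pos_mult_at_top[OF tendsto_const _ ln_at_top]) auto
  then have "filterlim h at_top at_top"
    unfolding h_def by (rule filterlim_tendsto_add_at_top[OF lim])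
  then have "\<forall>\<^sub>F z in at_top. h z > h Z"
    by (simp add: filterlim_at_top_dense)
  with bdd have "\<forall>\<^sub>F z::real in at_top. False"
    by eventually_elim simp
  then show False
    by simp
qed

text \<open>Integrating the asymptotics of \<open>l'\<close> from \<open>z\<close> to infinity:
  \<open>c / m * z powr (- m)\<close> is the function vanishing at infinity with derivative
  \<open>- c * z powr (- b)\<close>, and \<open>l\<close> is squeezed between two such functions
  with \<open>c\<close> on either side of \<open>a\<close>.\<close>

lemma tail_asymptotics:
  fixes l :: "real \<Rightarrow> real"
  assumes der: "\<And>t. (l has_real_derivative l' t) (at t)"
    and lim: "(l \<longlongrightarrow> 0) at_top"
    and "a > 0" and "b > 1"
    and asym: "((\<lambda>z. - l' z / (a * z powr (- b))) \<longlongrightarrow> 1) at_top"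
  shows "((\<lambda>s. s powr (b - 1) * l s) \<longlongrightarrow> a / (b - 1)) at_top"
proof -
  define m where "m = b - 1"
  have "m > 0" using \<open>b > 1\<close> by (simp add: m_def)
  \<comment> \<open>Since \<open>g c\<close> vanishes at infinity, an eventually constant sign of
    its derivative forces the opposite sign on \<open>g c\<close> itself, in the weak sense.\<close>
  define g where "g = (\<lambda>c z. l z - c / m * z powr (- m))"
  have dg: "(g c has_real_derivative l' z + c * z powr (- b)) (at z)" if "z > 0" for c z
  proof -
    have "((\<lambda>z. z powr (- m)) has_real_derivative - m * z powr (- b)) (at z)"
      using that by (auto intro!: derivative_eq_intros simp: m_def)
    from DERIV_diff[OF der DERIV_cmult[OF this, of "c / m"]] show ?thesis
      using \<open>m > 0\<close> by (simp add: g_def)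
  qed
  have lg: "(g c \<longlongrightarrow> 0) at_top" for c
  proof -
    have "((\<lambda>z. z powr (- m)) \<longlongrightarrow> 0) at_top"
      using \<open>m > 0\<close> by (intro tendsto_neg_powr filterlim_ident) auto
    from tendsto_diff[OF lim tendsto_mult_right_zero[OF this], of "c / m"] show ?thesis
      unfolding g_def by simp
  qed
  have g_eq: "z powr m * l z = c / m + z powr m * g c z" if "z > 0" for c z
    using that \<open>m > 0\<close> by (simp add: g_def algebra_simps powr_minus)
  have "((\<lambda>s. s powr m * l s) \<longlongrightarrow> a / m) at_top"
  proof (rule order_tendstoI)
    fix r assume "r < a / m"
    then have "r * m < a" using \<open>m > 0\<close> by (simp add: field_simps)
    \<comment> \<open>\<open>c < a\<close> makes the derivative of \<open>g c\<close> eventually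
      nonpositive, while \<open>r * m < c\<close> leaves room for the strict bound by
      \<open>r\<close>.\<close>
    then obtain c where c: "r * m < c" "c < a" using dense by blast
    have "\<forall>\<^sub>F z in at_top. - l' z / (a * z powr (- b)) > c / a"
      using order_tendstoD(1)[OF asym, of "c / a"] c \<open>a > 0\<close> by simp
    then obtain Z0 where Z0: "\<And>z. z \<ge> Z0 \<Longrightarrow> - l' z / (a * z powr (- b)) > c / a"
      by (auto simp: eventually_at_top_linorder)
    have "r < z powr m * l z" if "z \<ge> max Z0 1" for z
    proof -
      have "l' t + c * t powr (- b) \<le> 0" if "t \<ge> z" for t
        using Z0[of t] that \<open>z \<ge> max Z0 1\<close> \<open>a > 0\<close> by (simp add: field_simps)
      then have "g c z \<ge> 0"
        using that by (intro nonneg_if_deriv_nonpos_tendsto_0[OF dg _ lg]) auto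
      then have "c / m \<le> z powr m * l z"
        using that by (subst g_eq[of z c]) auto
      moreover have "r < c / m" using c \<open>m > 0\<close> by (simp add: field_simps)
      ultimately show ?thesis by simp
    qed
    then show "\<forall>\<^sub>F z in at_top. r < z powr m * l z"
      using eventually_at_top_linorder by blast
  next
    fix r assume "a / m < r"
    then have "a < r * m" using \<open>m > 0\<close> by (simp add: field_simps)
    then obtain c where c: "a < c" "c < r * m" using dense by blast
    have "\<forall>\<^sub>F z in at_top. - l' z / (a * z powr (- b)) < c / a"
      using order_tendstoD(2)[OF asym, of "c / a"] c \<open>a > 0\<close> by simp
    then obtain Z0 where Z0: "\<And>z. z \<ge> Z0 \<Longrightarrow> - l' z / (a * z powr (- b)) < c / a"
      by (auto simp: eventually_at_top_linorder)
    have "z powr m * l z < r" if "z \<ge> max Z0 1" for z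
    proof -
      have *: "- (l' t + c * t powr (- b)) \<le> 0" if "t \<ge> z" for t
        using Z0[of t] that \<open>z \<ge> max Z0 1\<close> \<open>a > 0\<close> by (simp add: field_simps)
      have "- g c z \<ge> 0"
      proof (rule nonneg_if_deriv_nonpos_tendsto_0[where f = "\<lambda>t. - g c t", OF _ *])
        show "((\<lambda>t. - g c t) has_real_derivative - (l' t + c * t powr (- b))) (at t)"
          if "t \<ge> z" for t
          using that \<open>z \<ge> max Z0 1\<close> by (intro DERIV_minus dg) auto
        show "((\<lambda>t. - g c t) \<longlongrightarrow> 0) at_top"
          using tendsto_minus[OF lg[of c]] by simp
      qed
      then have "z powr m * l z \<le> c / m"
        using that by (subst g_eq[of z c]) (auto simp: mult_nonneg_nonpos)
      moreover have "c / m < r" using c \<open>m > 0\<close> by (simp add: field_simps)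
      ultimately show ?thesis by simp
    qed
    then show "\<forall>\<^sub>F z in at_top. z powr m * l z < r"
      using eventually_at_top_linorder by blast
  qed
  then show ?thesis by (simp add: m_def)
qed

text \<open>Write \<open>B powr m * l (B * t)\<close> as
  \<open>(B * t) powr m * l (B * t) * t powr (- m)\<close> and note that \<open>B * t\<close> tends
  to infinity. Letting \<open>t\<close> vary covers margins along a convergent sequence of
  directions.\<close>

lemma rescaled_tail_tendsto:
  fixes l :: "real \<Rightarrow> real" and B t :: "'a \<Rightarrow> real"
  assumes tail: "((\<lambda>s. s powr m * l s) \<longlongrightarrow> c) at_top"
    and B: "filterlim B at_top F"
    and t: "(t \<longlongrightarrow> t0) F" and "t0 > 0"
  shows "((\<lambda>k. B k powr m * l (B k * t k)) \<longlongrightarrow> c * t0 powr (- m)) F"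
proof -
  have "filterlim (\<lambda>k. B k * t k) at_top F"
    using filterlim_tendsto_pos_mult_at_top[OF t \<open>t0 > 0\<close> B] by (simp add: mult.commute)
  from filterlim_compose[OF tail this]
  have "((\<lambda>k. (B k * t k) powr m * l (B k * t k) * t k powr (- m)) \<longlongrightarrow> c * t0 powr (- m)) F"
    using t \<open>t0 > 0\<close> by (intro tendsto_intros) auto
  moreover have "\<forall>\<^sub>F k in F. (B k * t k) powr m * l (B k * t k) * t k powr (- m) = B k powr m * l (B k * t k)"
  proof -
    have "\<forall>\<^sub>F k in F. B k > 0"
      using B by (simp add: filterlim_at_top_dense)
    moreover have "\<forall>\<^sub>F k in F. t k > 0"
      using order_tendstoD(1)[OF t \<open>t0 > 0\<close>] .
    ultimately show ?thesis
      by eventually_elim (simp add: powr_mult powr_minus field_simps)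
  qed
  ultimately show ?thesis
    by (rule Lim_transform_eventually)
qed

section \<open>The limiting problem\<close>

lemma powr_neg_midpoint_le:
  fixes p q m :: real
  assumes "p > 0" "q > 0" "m > 0"
  shows "((p + q) / 2) powr (- m) \<le> (p powr (- m) + q powr (- m)) / 2"
proof -
  have "convex_on {0<..} (\<lambda>x::real. x powr (- m))"
  proof (rule f''_ge0_imp_convex)
    show "((\<lambda>x. x powr (- m)) has_real_derivative - m * x powr (- m - 1)) (at x)"
      if "x \<in> {0<..}" for x
      using that by (auto intro!: derivative_eq_intros)
    show "((\<lambda>x. - m * x powr (- m - 1)) has_real_derivative - m * ((- m - 1) * x powr (- m - 1 - 1))) (at x)"
      if "x \<in> {0<..}" for x
      using that by (auto intro!: derivative_eq_intros)
    show "0 \<le> - m * ((- m - 1) * x powr (- m - 1 - 1))" if "x \<in> {0<..}" for x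
      using that \<open>m > 0\<close> by (intro mult_nonpos_nonpos) (auto simp: mult_nonpos_nonneg)
  qed auto
  from convex_onD[OF this, of "1/2" p q] assms show ?thesis
    by (simp add: field_simps)
qed

text \<open>Strict convexity of the unit ball, from the parallelogram law.\<close>

lemma norm_midpoint_less_1:
  fixes u v :: "'a::real_inner"
  assumes "norm u \<le> 1" "norm v \<le> 1" "u \<noteq> v"
  shows "norm ((1 / 2) *\<^sub>R (u + v)) < 1"
proof -
  have "(norm (u + v))\<^sup>2 + (norm (u - v))\<^sup>2 = 2 * (norm u)\<^sup>2 + 2 * (norm v)\<^sup>2"
    by (simp add: power2_norm_eq_inner inner_simps inner_commute)
  moreover have "(norm u)\<^sup>2 \<le> 1" "(norm v)\<^sup>2 \<le> 1"
    using assms by (simp_all add: power_le_one)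
  moreover have "(norm (u - v))\<^sup>2 > 0"
    using assms by simp
  ultimately have "(norm (u + v))\<^sup>2 < 4"
    by linarith
  then show ?thesis
    using power_less_imp_less_base[of "norm (u + v)" 2 2] by simp
qed

lemma sum_powr_neg_minimizer_unique:
  fixes z :: "'i \<Rightarrow> 'a::real_inner" and u v :: 'a and I :: "'i set" and m :: real
  defines "G \<equiv> \<lambda>w. \<Sum>i\<in>I. (w \<bullet> z i) powr (- m)"
  assumes I: "finite I" "I \<noteq> {}" and "m > 0"
    and u: "norm u \<le> 1" "\<And>i. i \<in> I \<Longrightarrow> u \<bullet> z i > 0"
    and v: "norm v \<le> 1" "\<And>i. i \<in> I \<Longrightarrow> v \<bullet> z i > 0"
    and min_u: "\<And>w. norm w \<le> 1 \<Longrightarrow> (\<And>i. i \<in> I \<Longrightarrow> w \<bullet> z i > 0) \<Longrightarrow> G u \<le> G w"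
    and min_v: "\<And>w. norm w \<le> 1 \<Longrightarrow> (\<And>i. i \<in> I \<Longrightarrow> w \<bullet> z i > 0) \<Longrightarrow> G v \<le> G w"
  shows "u = v"
proof (rule ccontr)
  assume "u \<noteq> v"
  define w where "w = (1 / 2) *\<^sub>R (u + v)"
  have w1: "norm w < 1"
    unfolding w_def using norm_midpoint_less_1[OF u(1) v(1) \<open>u \<noteq> v\<close>] .
  have w_inner: "w \<bullet> z i = (u \<bullet> z i + v \<bullet> z i) / 2" for i
    by (simp add: w_def inner_simps)
  have w_pos: "w \<bullet> z i > 0" if "i \<in> I" for i
    using u(2)[OF that] v(2)[OF that] by (simp add: w_inner)
  \<comment> \<open>A positive inner product with some \<open>z i\<close> excludes
    \<open>w = 0\<close>; this is where a nonempty \<open>I\<close> enters first, and strictness of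
    the sum below uses it again.\<close>
  have "norm w > 0"
    using w_pos I(2) by force
  have sgn_inner: "sgn w \<bullet> z i > w \<bullet> z i" if "i \<in> I" for i
    using w_pos[OF that] w1 \<open>norm w > 0\<close> by (simp add: sgn_div_norm field_simps)
  have sgn_pos: "sgn w \<bullet> z i > 0" if "i \<in> I" for i
    using sgn_inner[OF that] w_pos[OF that] by simp
  \<comment> \<open>Normalising \<open>w\<close> divides every margin by \<open>norm w < 1\<close>,
    so all margins grow and each negative power drops.\<close>
  have "G (sgn w) < G w"
    unfolding G_def using I sgn_inner w_pos \<open>m > 0\<close>
    by (intro sum_strict_mono powr_less_mono2_neg) auto
  also have "G w \<le> (\<Sum>i\<in>I. ((u \<bullet> z i) powr (- m) + (v \<bullet> z i) powr (- m)) / 2)"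
    unfolding G_def w_inner using u(2) v(2) \<open>m > 0\<close>
    by (intro sum_mono powr_neg_midpoint_le) auto
  also have "\<dots> = (G u + G v) / 2"
    by (simp add: G_def sum.distrib flip: sum_divide_distrib)
  also have "\<dots> \<le> G (sgn w)"
    using min_u[OF _ sgn_pos] min_v[OF _ sgn_pos] \<open>norm w > 0\<close> by (simp add: norm_sgn)
  finally show False by simp
qed

section \<open>Cluster points of the rescaled minimisers\<close>

text \<open>If the limit \<open>u0\<close> had a nonpositive margin, the corresponding rescaled loss
  alone would eventually exceed the bounded rescaled risk of the separator \<open>s\<close>. Once
  all margins of \<open>u0\<close> are positive, the inequality between the rescaled risks of
  \<open>u k\<close> and \<open>v\<close> passes to the limit.\<close>

lemma cluster_point_minimizes:
  fixes z :: "'i \<Rightarrow> 'a::real_inner" and l :: "real \<Rightarrow> real" and u :: "nat \<Rightarrow> 'a"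
  assumes I: "finite I" and "m > 0" "c > 0"
    and tail: "((\<lambda>s. s powr m * l s) \<longlongrightarrow> c) at_top"
    and anti: "antimono l" and pos: "\<And>s. l s > 0"
    and B: "filterlim B at_top sequentially"
    and min: "\<And>k v. B k > 0 \<Longrightarrow> norm v \<le> 1 \<Longrightarrow>
      (\<Sum>i\<in>I. l (B k * (u k \<bullet> z i))) \<le> (\<Sum>i\<in>I. l (B k * (v \<bullet> z i)))"
    and lim: "u \<longlonglongrightarrow> u0"
    and sep: "norm s \<le> 1" "\<And>i. i \<in> I \<Longrightarrow> s \<bullet> z i > 0"
  shows "\<And>i. i \<in> I \<Longrightarrow> u0 \<bullet> z i > 0"
    and "\<And>v. norm v \<le> 1 \<Longrightarrow> (\<And>i. i \<in> I \<Longrightarrow> v \<bullet> z i > 0) \<Longrightarrow>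
      (\<Sum>i\<in>I. (u0 \<bullet> z i) powr (- m)) \<le> (\<Sum>i\<in>I. (v \<bullet> z i) powr (- m))"
proof -
  define R where "R = (\<lambda>k v. \<Sum>i\<in>I. B k powr m * l (B k * (v \<bullet> z i)))"
  define G where "G = (\<lambda>v. \<Sum>i\<in>I. (v \<bullet> z i) powr (- m))"
  have Bpos: "\<forall>\<^sub>F k in sequentially. B k > 0"
    using B by (simp add: filterlim_at_top_dense)
  have R_le: "\<forall>\<^sub>F k in sequentially. R k (u k) \<le> R k v" if "norm v \<le> 1" for v
    using Bpos
    by eventually_elim (use min that in \<open>auto simp: R_def simp flip: sum_distrib_left intro!: mult_left_mono\<close>)
  have R_lim: "(\<lambda>k. R k (v k)) \<longlonglongrightarrow> c * G v0"
    if "v \<longlonglongrightarrow> v0" "\<And>i. i \<in> I \<Longrightarrow> v0 \<bullet> z i > 0" for v v0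
    unfolding R_def G_def sum_distrib_left
    by (intro tendsto_sum rescaled_tail_tendsto[OF tail B] tendsto_inner tendsto_const that)
  show u0_pos: "u0 \<bullet> z i > 0" if "i \<in> I" for i
  proof (rule ccontr)
    assume "\<not> u0 \<bullet> z i > 0"
    define M where "M = c * G s"
    have "M \<ge> 0"
      using \<open>c > 0\<close> by (simp add: M_def G_def sum_nonneg)
    \<comment> \<open>The margin \<open>e\<close> solves \<open>c * e powr (- m) = M + 1\<close>:
      the rescaled loss at this margin tends to one more than the limit \<open>M\<close> of the
      rescaled risk of \<open>s\<close>.\<close>
    define e where "e = ((M + 1) / c) powr (- 1 / m)"
    have "e > 0"
      using \<open>M \<ge> 0\<close> \<open>c > 0\<close> by (auto simp: e_def)
    have ce: "c * e powr (- m) = M + 1"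
      using \<open>M \<ge> 0\<close> \<open>c > 0\<close> \<open>m > 0\<close> by (simp add: e_def powr_powr)
    have "(\<lambda>k. u k \<bullet> z i) \<longlonglongrightarrow> u0 \<bullet> z i"
      by (intro tendsto_intros lim)
    then have "\<forall>\<^sub>F k in sequentially. u k \<bullet> z i < e"
      using order_tendstoD(2) \<open>e > 0\<close> \<open>\<not> u0 \<bullet> z i > 0\<close> by (metis not_less order_le_less_trans)
    with Bpos R_le[OF sep(1)] have "\<forall>\<^sub>F k in sequentially. B k powr m * l (B k * e) \<le> R k s"
    proof eventually_elim
      case (elim k)
      have "B k powr m * l (B k * e) \<le> B k powr m * l (B k * (u k \<bullet> z i))"
        using elim by (intro mult_left_mono antimonoD[OF anti]) auto
      \<comment> \<open>Positivity of \<open>l\<close> allows the other summands to be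
        dropped.\<close>
      also have "\<dots> \<le> R k (u k)"
        unfolding R_def using I \<open>i \<in> I\<close> pos
        by (intro member_le_sum[of i I "\<lambda>i. B k powr m * l (B k * (u k \<bullet> z i))"])
          (auto simp: less_imp_le)
      finally show ?case
        using elim by simp
    qed
    moreover have "(\<lambda>k. B k powr m * l (B k * e)) \<longlonglongrightarrow> c * e powr (- m)"
      by (rule rescaled_tail_tendsto[OF tail B tendsto_const \<open>e > 0\<close>])
    moreover have "(\<lambda>k. R k s) \<longlonglongrightarrow> M"
      unfolding M_def by (rule R_lim[OF tendsto_const sep(2)])
    ultimately have "M + 1 \<le> M"
      using tendsto_le[OF sequentially_bot] ce by metis
    then show False by simp
  qed
  show "G u0 \<le> G v" if "norm v \<le> 1" "\<And>i. i \<in> I \<Longrightarrow> v \<bullet> z i > 0" for v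
  proof -
    have "c * G u0 \<le> c * G v"
      using R_lim[OF tendsto_const that(2)] R_lim[OF lim u0_pos] R_le[OF that(1)]
      by (rule tendsto_le[OF sequentially_bot])
    then show ?thesis using \<open>c > 0\<close> by simp
  qed
qed

section \<open>Convergence by compactness, existence of minimisers, and the conclusion\<close>

text \<open>Some sequence of parameters gives a cluster point \<open>L\<close>. If \<open>f\<close>
  did not converge to \<open>L\<close>, parameters going to infinity along which \<open>f\<close>
  stays away from \<open>L\<close> would give, by compactness, a cluster point different from
  \<open>L\<close>.\<close>

lemma compact_tendsto_at_top:
  fixes f :: "real \<Rightarrow> 'a::metric_space"
  assumes "compact K" and K: "\<And>B. B > 0 \<Longrightarrow> f B \<in> K"
    and unique: "\<And>X Y p q. \<lbrakk>filterlim X at_top sequentially; filterlim Y at_top sequentially;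
      (\<lambda>k. f (X k)) \<longlonglongrightarrow> p; (\<lambda>k. f (Y k)) \<longlonglongrightarrow> q; p \<in> K; q \<in> K\<rbrakk> \<Longrightarrow> p = q"
  shows "\<exists>L. (f \<longlongrightarrow> L) at_top"
proof -
  have subseq: "\<exists>p\<in>K. \<exists>r. strict_mono r \<and> (\<lambda>k. f (X (r k))) \<longlonglongrightarrow> p"
    if "\<And>k. X k > 0" for X :: "nat \<Rightarrow> real"
  proof -
    have "\<forall>k. (\<lambda>k. f (X k)) k \<in> K"
      using K[OF that] by simp
    then obtain p r where "p \<in> K" "strict_mono r" "((\<lambda>k. f (X k)) \<circ> r) \<longlonglongrightarrow> p"
      by (rule seq_compactE[OF compact_imp_seq_compact[OF \<open>compact K\<close>]])
    then show ?thesis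
      by (auto simp: comp_def)
  qed
  have X0: "filterlim (\<lambda>k. real (Suc k)) at_top sequentially"
    by (rule filterlim_compose[OF filterlim_real_sequentially filterlim_Suc])
  obtain L r where L: "L \<in> K" "strict_mono r" "(\<lambda>k. f (real (Suc (r k)))) \<longlonglongrightarrow> L"
    using subseq[of "\<lambda>k. real (Suc k)"] by auto
  have Lr: "filterlim (\<lambda>k. real (Suc (r k))) at_top sequentially"
    using filterlim_compose[OF X0 filterlim_subseq[OF L(2)]] .
  have "(f \<longlongrightarrow> L) at_top"
  proof (rule ccontr)
    assume "\<not> (f \<longlongrightarrow> L) at_top"
    then obtain e where "e > 0" and e: "\<not> (\<forall>\<^sub>F B in at_top. dist (f B) L < e)"
      by (auto simp: tendsto_iff)
    \<comment> \<open>The bound \<open>Suc k\<close> makes the parameters diverge and also keeps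
      them positive, so that \<open>f\<close> takes its values in \<open>K\<close>.\<close>
    from e have "\<exists>B\<ge>real (Suc k). \<not> dist (f B) L < e" for k
      unfolding eventually_at_top_linorder by blast
    then obtain X where X: "\<And>k. X k \<ge> real (Suc k)" "\<And>k. \<not> dist (f (X k)) L < e"
      by metis
    have "X k > 0" for k
      using X(1)[of k] by simp
    then obtain q r' where q: "q \<in> K" "strict_mono r'" "(\<lambda>k. f (X (r' k))) \<longlonglongrightarrow> q"
      using subseq[of X] by auto
    have "filterlim X at_top sequentially"
      using filterlim_at_top_mono[OF X0] X(1) by simp
    then have "filterlim (\<lambda>k. X (r' k)) at_top sequentially"
      using filterlim_compose filterlim_subseq[OF q(2)] by blast
    then have "q = L"
      using unique Lr L q by blast
    then have "\<forall>\<^sub>F k in sequentially. dist (f (X (r' k))) L < e"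
      using q(3) \<open>e > 0\<close> by (simp add: tendsto_iff)
    then show False
      using X(2) by simp
  qed
  then show ?thesis ..
qed

text \<open>\<open>ARG_MIN\<close> is a choice operator, so its value is a minimiser only once one
  is known to exist; compactness of the ball and continuity of the risk supply it.\<close>

lemma constrained_minimizer_is_minimizer:
  fixes x :: "nat \<Rightarrow> real ^ 'd"
  assumes "continuous_on UNIV l" and "B \<ge> 0"
  shows "norm (constrained_minimizer l n x y B) \<le> B"
    and "norm v \<le> B \<Longrightarrow>
      empirical_risk l n x y (constrained_minimizer l n x y B) \<le> empirical_risk l n x y v"
proof -
  have "continuous_on (cball 0 B) (empirical_risk l n x y)"
    unfolding empirical_risk_def
    by (intro continuous_intros continuous_on_compose2[OF assms(1)]) auto
  from continuous_attains_inf[OF compact_cball _ this] \<open>B \<ge> 0\<close>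
  obtain w where w: "norm w \<le> B"
    "\<And>v. norm v \<le> B \<Longrightarrow> empirical_risk l n x y w \<le> empirical_risk l n x y v"
    by (auto simp: not_less)
  have "is_arg_min (empirical_risk l n x y) (\<lambda>w. norm w \<le> B) w"
    using w by (auto simp: is_arg_min_linorder)
  then have "is_arg_min (empirical_risk l n x y) (\<lambda>w. norm w \<le> B) (constrained_minimizer l n x y B)"
    unfolding constrained_minimizer_def arg_min_def by (rule someI)
  then show "norm (constrained_minimizer l n x y B) \<le> B"
    and "norm v \<le> B \<Longrightarrow>
      empirical_risk l n x y (constrained_minimizer l n x y B) \<le> empirical_risk l n x y v"
    by (auto simp: is_arg_min_linorder)
qed

lemma strictly_decreasing_to_zero_pos:
  assumes "strictly_decreasing_to_zero l"
  shows "l s > 0"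
proof -
  \<comment> \<open>The limit only gives a weak bound, so it is applied at \<open>s + 1\<close>; the
    strict decrease from \<open>s\<close> to \<open>s + 1\<close> then yields strict
    positivity.\<close>
  have "\<forall>\<^sub>F t in at_top. l t \<le> l (s + 1)"
    using eventually_ge_at_top[of "s + 1"]
    by eventually_elim (use assms in \<open>force simp: strictly_decreasing_to_zero_def order_le_less\<close>)
  then have "l (s + 1) \<ge> 0"
    using assms tendsto_upperbound[of l 0 at_top "l (s + 1)"] by (simp add: strictly_decreasing_to_zero_def)
  moreover have "l (s + 1) < l s"
    using assms by (simp add: strictly_decreasing_to_zero_def)
  ultimately show ?thesis by simp
qed

theorem proposition11:
  fixes x :: "nat \<Rightarrow> real ^ 'd"
    and y :: "nat \<Rightarrow> real"
    and l :: "real \<Rightarrow> real"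
    and n :: nat
    and a b :: real
  assumes "n \<ge> 1"
    and "\<And>i. i \<in> {1..n} \<Longrightarrow> norm (x i) \<le> 1"
    and "\<And>i. i \<in> {1..n} \<Longrightarrow> y i \<in> {-1, 1}"
    and "linearly_separable n x y"
    and "convex_on UNIV l"
    and "l differentiable_on UNIV"
    and "strictly_decreasing_to_zero l"
    and "a > 0" and "b > 0"
    and "((\<lambda>z. - deriv l z / (a * z powr (- b))) \<longlongrightarrow> 1) at_top"
  shows "\<exists>L. ((\<lambda>B. constrained_minimizer l n x y B /\<^sub>R B) \<longlongrightarrow> L) at_top"
proof -
  \<comment> \<open>Absorbing the labels into the data turns every margin into a plain inner product
    with \<open>z i\<close>.\<close>
  define z where "z = (\<lambda>i. y i *\<^sub>R x i)"
  define m where "m = b - 1"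
  define u where "u = (\<lambda>B. constrained_minimizer l n x y B /\<^sub>R B)"
  have der: "(l has_real_derivative deriv l t) (at t)" for t
    using \<open>l differentiable_on UNIV\<close>
    by (simp add: differentiable_on_def field_differentiable_derivI field_differentiable_def
        real_differentiable_def)
  have lim: "(l \<longlongrightarrow> 0) at_top"
    using \<open>strictly_decreasing_to_zero l\<close> by (simp add: strictly_decreasing_to_zero_def)
  have "antimono l"
    using \<open>strictly_decreasing_to_zero l\<close>
    by (intro antimonoI) (auto simp: strictly_decreasing_to_zero_def order_le_less)
  have "b > 1"
    using tail_exponent_gt_1[OF der lim] assms by simp
  then have "m > 0" "a / m > 0"
    using \<open>a > 0\<close> by (simp_all add: m_def)
  have tail: "((\<lambda>s. s powr m * l s) \<longlongrightarrow> a / m) at_top"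
    unfolding m_def using tail_asymptotics[OF der lim] assms \<open>b > 1\<close> by simp
  have cont: "continuous_on UNIV l"
    using \<open>l differentiable_on UNIV\<close> by (rule differentiable_imp_continuous_on)
  obtain s where s: "norm s \<le> 1" "\<And>i. i \<in> {1..n} \<Longrightarrow> s \<bullet> z i > 0"
    using \<open>linearly_separable n x y\<close> unfolding linearly_separable_def z_def
    by (metis inner_scaleR_right less_le_trans order_refl)
  have risk: "empirical_risk l n x y (B *\<^sub>R w) = (1 / real n) * (\<Sum>i=1..n. l (B * (w \<bullet> z i)))" for B w
    by (simp add: empirical_risk_def z_def mult.left_commute)
  have u_norm: "norm (u B) \<le> 1" if "B > 0" for B
    using constrained_minimizer_is_minimizer(1)[OF cont, of B n x y] that
    by (simp add: u_def field_simps)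
  have u_min: "(\<Sum>i=1..n. l (B * (u B \<bullet> z i))) \<le> (\<Sum>i=1..n. l (B * (v \<bullet> z i)))"
    if "B > 0" "norm v \<le> 1" for B v
  proof -
    \<comment> \<open>\<open>B *\<^sub>R u B\<close> is the constrained minimiser, and
      \<open>B *\<^sub>R v\<close> is an admissible competitor because
      \<open>norm v \<le> 1\<close>.\<close>
    have "empirical_risk l n x y (B *\<^sub>R u B) \<le> empirical_risk l n x y (B *\<^sub>R v)"
      using constrained_minimizer_is_minimizer(2)[OF cont, of B "B *\<^sub>R v" n x y] that
      by (simp add: u_def mult_left_le)
    then show ?thesis
      using \<open>n \<ge> 1\<close> by (simp add: risk divide_right_mono field_simps)
  qed
  have "\<exists>L. (u \<longlongrightarrow> L) at_top"
  proof (rule compact_tendsto_at_top)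
    show "compact (cball (0 :: real ^ 'd) 1)" by simp
    show "u B \<in> cball 0 1" if "B > 0" for B
      using u_norm[OF that] by simp
    fix X Y :: "nat \<Rightarrow> real" and p q
    assume X: "filterlim X at_top sequentially" and Y: "filterlim Y at_top sequentially"
      and p: "(\<lambda>k. u (X k)) \<longlonglongrightarrow> p" and q: "(\<lambda>k. u (Y k)) \<longlonglongrightarrow> q"
      and pq: "p \<in> cball 0 1" "q \<in> cball 0 1"
    note cluster = cluster_point_minimizes[OF finite_atLeastAtMost \<open>m > 0\<close> \<open>a / m > 0\<close> tail \<open>antimono l\<close>
        strictly_decreasing_to_zero_pos[OF \<open>strictly_decreasing_to_zero l\<close>] _ _ _ s]
    \<comment> \<open>Both cluster points separate the data and minimise the same limiting sum, so
      uniqueness of its minimiser identifies them.\<close>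
    note P = cluster[OF X u_min p] and Q = cluster[OF Y u_min q]
    show "p = q"
    proof (rule sum_powr_neg_minimizer_unique[of "{1..n}" m p z q])
      show "{1..n} \<noteq> {}" using \<open>n \<ge> 1\<close> by simp
    qed (use pq P Q \<open>m > 0\<close> in auto)
  qed
  then show ?thesis
    by (simp add: u_def)
qed

end
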